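(* For any Tychonoff space $X$, the following conditions are equivalent: (i) the free topological group $F_G(X)$ is an $F'$-space; (ii) the free Abelian topological group $A_G(X)$ is an $F'$-space; (iii) $X$ is a $P$-space.
   Context: A space is an $F'$-space if any two disjoint cozero sets in it have disjoint closures; it is a $P$-space if every $G_\delta$-set is open. For a Tychonoff space $X$ with a fixed point $x_0$, the (Graev) free topological group $F_G(X)$ is the unique topological group with identity $x_0$ containing $X$ as a subspace such that every continuous map from $X$ to a topological group sending $x_0$ to the identity extends to a continuous homomorphism $F_G(X)\to G$; it does not depend on the choice of $x_0$ up to topological isomorphism. The (Graev) free Abelian topological group $A_G(X)$ is defined analogously with Abelian groups in place of groups. *)

theory Defs
  imports "HOL-Analysis.Analysis" "HOL-Algebra.Free_Abelian_Groups"
begin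

definition topological_group :: "('g, 'm) monoid_scheme \<Rightarrow> 'g topology \<Rightarrow> bool" where
  "topological_group G T \<longleftrightarrow>
     group G \<and> topspace T = carrier G \<and>
     continuous_map (prod_topology T T) T (\<lambda>(x, y). x \<otimes>\<^bsub>G\<^esub> y) \<and>
     continuous_map T T (\<lambda>x. inv\<^bsub>G\<^esub> x)"

definition finest_group_topology ::
    "('g, 'm) monoid_scheme \<Rightarrow> 'a topology \<Rightarrow> ('a \<Rightarrow> 'g) \<Rightarrow> 'g topology" where
  "finest_group_topology G X e =
     topology_generated_by
       (\<Union>{{U. openin T U} | T. topological_group G T \<and> continuous_map X T e})"

text \<open>Letters are pairs (x, True) for x and (x, False) for its inverse.\<close>
fun reduce_word :: "('a \<times> bool) list \<Rightarrow> ('a \<times> bool) list" where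
  "reduce_word [] = []"
| "reduce_word (a # w) =
     (case reduce_word w of
        [] \<Rightarrow> [a]
      | b # v \<Rightarrow> (if fst a = fst b \<and> snd a \<noteq> snd b then v else a # b # v))"

fun reduced_word :: "('a \<times> bool) list \<Rightarrow> bool" where
  "reduced_word [] = True"
| "reduced_word [a] = True"
| "reduced_word (a # b # w) =
     (\<not> (fst a = fst b \<and> snd a \<noteq> snd b) \<and> reduced_word (b # w))"

definition free_group :: "'a set \<Rightarrow> ('a \<times> bool) list monoid" where
  "free_group S =
     \<lparr>carrier = {w. fst ` set w \<subseteq> S \<and> reduced_word w},
      monoid.mult = (\<lambda>u v. reduce_word (u @ v)),
      one = []\<rparr>"

text \<open>Graev: the free group on X minus the base point x0, where x0 is identified
  with the identity.\<close>
definition graev_ins :: "'a \<Rightarrow> 'a \<Rightarrow> ('a \<times> bool) list" where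
  "graev_ins x0 x = (if x = x0 then [] else [(x, True)])"

definition graev_free_group :: "'a topology \<Rightarrow> 'a \<Rightarrow> ('a \<times> bool) list monoid" where
  "graev_free_group X x0 = free_group (topspace X - {x0})"

definition graev_free_topology :: "'a topology \<Rightarrow> 'a \<Rightarrow> ('a \<times> bool) list topology" where
  "graev_free_topology X x0 = finest_group_topology (graev_free_group X x0) X (graev_ins x0)"

definition graev_ab_ins :: "'a \<Rightarrow> 'a \<Rightarrow> 'a \<Rightarrow>\<^sub>0 int" where
  "graev_ab_ins x0 x = (if x = x0 then 0 else frag_of x)"

definition graev_free_ab_group :: "'a topology \<Rightarrow> 'a \<Rightarrow> ('a \<Rightarrow>\<^sub>0 int) monoid" where
  "graev_free_ab_group X x0 = free_Abelian_group (topspace X - {x0})"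

definition graev_free_ab_topology :: "'a topology \<Rightarrow> 'a \<Rightarrow> ('a \<Rightarrow>\<^sub>0 int) topology" where
  "graev_free_ab_topology X x0 =
     finest_group_topology (graev_free_ab_group X x0) X (graev_ab_ins x0)"

definition tychonoff_space :: "'a topology \<Rightarrow> bool" where
  "tychonoff_space X \<longleftrightarrow> completely_regular_space X \<and> t1_space X"

definition cozero_set :: "'a topology \<Rightarrow> 'a set \<Rightarrow> bool" where
  "cozero_set X U \<longleftrightarrow>
     (\<exists>f. continuous_map X euclideanreal f \<and> U = {x \<in> topspace X. f x \<noteq> 0})"

definition F'_space :: "'a topology \<Rightarrow> bool" where
  "F'_space X \<longleftrightarrow>
     (\<forall>U V. cozero_set X U \<and> cozero_set X V \<and> U \<inter> V = {} \<longrightarrow>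
            X closure_of U \<inter> X closure_of V = {})"

definition P_space :: "'a topology \<Rightarrow> bool" where
  "P_space X \<longleftrightarrow> (\<forall>S. gdelta_in X S \<longrightarrow> openin X S)"

end

theory Submission
  imports Defs
begin

text \<open>
  If \<open>X\<close> is a \<open>P\<close>-space, then declaring all \<open>G\<^sub>\<delta>\<close>-sets of the free topological group open yields
  another group topology that makes the insertion of \<open>X\<close> continuous, so by maximality the free
  group is itself a \<open>P\<close>-space, and cozero sets in a \<open>P\<close>-space are clopen. Conversely, if \<open>X\<close> is not
  a \<open>P\<close>-space, there are a continuous \<open>f \<ge> 0\<close> and a zero \<open>p\<close> of \<open>f\<close> that is a limit of points where
  \<open>f > 0\<close>. The map \<open>f - f x\<^sub>0\<close> extends to a continuous homomorphism \<open>h\<close> into the reals, and the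
  identity is a limit both of \<open>x p\<inverse>\<close>, where \<open>h = f x > 0\<close>, and of \<open>p x\<inverse>\<close>, where \<open>h < 0\<close>. The
  argument is the same in the Abelian and the non-Abelian case.
\<close>

section \<open>P-spaces\<close>

lemma gdelta_in_sequence:
  assumes "gdelta_in X S"
  obtains C where "\<And>n::nat. openin X (C n)" "\<Inter>(range C) = S"
  using assms unfolding gdelta_in_descending by blast

lemma gdelta_in_continuous_map_preimage:
  assumes "continuous_map X Y f" and "gdelta_in Y S"
  shows "gdelta_in X {x \<in> topspace X. f x \<in> S}"
proof -
  obtain C where C: "\<And>n::nat. openin Y (C n)" "\<Inter>(range C) = S"
    using gdelta_in_sequence [OF assms(2)] by blast
  have "gdelta_in X (\<Inter>n. {x \<in> topspace X. f x \<in> C n})"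
    by (rule gdelta_in_Inter)
       (auto intro!: open_imp_gdelta_in openin_continuous_map_preimage [OF assms(1)] C)
  moreover have "(\<Inter>n. {x \<in> topspace X. f x \<in> C n}) = {x \<in> topspace X. f x \<in> S}"
    using C(2) by auto
  ultimately show ?thesis by simp
qed

lemma P_space_imp_F'_space:
  assumes "P_space X"
  shows "F'_space X"
proof -
  have "X closure_of U = U" if U: "cozero_set X U" for U
  proof -
    obtain f where f: "continuous_map X euclideanreal f" "U = {x \<in> topspace X. f x \<noteq> 0}"
      using U unfolding cozero_set_def by blast
    have "gdelta_in euclideanreal {0}"
      by (rule closed_imp_gdelta_in) (auto simp: metrizable_space_euclidean)
    then have "openin X {x \<in> topspace X. f x \<in> {0}}"
      using assms gdelta_in_continuous_map_preimage [OF f(1)] unfolding P_space_def by blast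
    moreover have "topspace X - U = {x \<in> topspace X. f x \<in> {0}}"
      using f(2) by auto
    ultimately show ?thesis
      using f(2) by (intro closure_of_closedin) (auto simp: closedin_def)
  qed
  then show ?thesis
    unfolding F'_space_def by simp
qed

text \<open>Complete regularity places inside a G_delta set, around each of its points, the zero set
  of a nonnegative continuous function. Read contrapositively, this supplies \<open>f\<close> and
  \<open>p\<close> for a space that is not a P-space.\<close>

lemma P_space_if_zero_sets_open:
  assumes X: "completely_regular_space X"
    and zero: "\<And>f p. \<lbrakk>continuous_map X euclideanreal f; \<And>x. x \<in> topspace X \<Longrightarrow> f x \<ge> 0;
                 p \<in> topspace X; f p = 0\<rbrakk>
               \<Longrightarrow> \<exists>W. openin X W \<and> p \<in> W \<and> (\<forall>x\<in>W. f x = 0)"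
  shows "P_space X"
  unfolding P_space_def
proof (intro allI impI)
  fix S assume S: "gdelta_in X S"
  obtain C where C: "\<And>n::nat. openin X (C n)" "\<Inter>(range C) = S"
    using gdelta_in_sequence [OF S] by blast
  show "openin X S"
  proof (subst openin_subopen, intro ballI)
    fix p assume p: "p \<in> S"
    then have pX: "p \<in> topspace X"
      using gdelta_in_subset [OF S] by blast
    have "\<exists>f. continuous_map X (top_of_set {0..1::real}) f \<and> f p = 0 \<and> f ` (topspace X - C n) \<subseteq> {1}"
      for n
      using X C p pX unfolding completely_regular_space_def by (auto simp: closedin_diff)
    then obtain f :: "nat \<Rightarrow> _ \<Rightarrow> real" where f:
      "\<And>n. continuous_map X (top_of_set {0..1}) (f n)" "\<And>n. f n p = 0"
      "\<And>n. f n ` (topspace X - C n) \<subseteq> {1}"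
      by metis
    have cont: "continuous_map X euclideanreal (f n)" for n
      using f(1)[of n] by (simp add: continuous_map_in_subtopology)
    have f01: "0 \<le> f n x" "f n x \<le> 1" if "x \<in> topspace X" for n x
      using f(1)[of n] that by (auto simp: continuous_map_in_subtopology image_subset_iff)
    \<comment> \<open>The geometric weights make the series converge uniformly, so \<open>g\<close>
      is continuous; since all terms are nonnegative, \<open>g x = 0\<close> forces
      \<open>f n x = 0\<close> for every \<open>n\<close>, which puts \<open>x\<close> in every
      \<open>C n\<close>.\<close>
    define g where "g x = suminf (\<lambda>n. (1/2)^n * f n x)" for x
    have unif: "uniform_limit (topspace X) (\<lambda>n x. \<Sum>i<n. (1/2)^i * f i x) g sequentially"
      unfolding g_def
      by (rule Weierstrass_m_test [where M = "\<lambda>n. (1/2)^n"])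
         (auto simp: abs_mult f01 mult_left_le intro!: summable_geometric)
    have "continuous_map X Met_TC.mtopology g"
    proof (rule Met_TC.continuous_map_uniform_limit)
      show "\<forall>\<^sub>F n in sequentially. continuous_map X Met_TC.mtopology (\<lambda>x. \<Sum>i<n. (1/2)^i * f i x)"
        by (auto intro!: always_eventually continuous_intros cont)
      show "\<forall>\<^sub>F n in sequentially. \<forall>x\<in>topspace X.
              g x \<in> UNIV \<and> dist (\<Sum>i<n. (1/2)^i * f i x) (g x) < e" if "e > 0" for e
        using uniform_limitD [OF unif that] by simp
    qed auto
    then have contg: "continuous_map X euclideanreal g" by simp
    have summ: "summable (\<lambda>n. (1/2)^n * f n x)" if "x \<in> topspace X" for x
      by (rule summable_comparison_test' [where g = "\<lambda>n. (1/2)^n" and N = 0])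
         (use that in \<open>auto simp: abs_mult f01 mult_left_le\<close>)
    have "g x \<ge> 0" if "x \<in> topspace X" for x
      unfolding g_def by (rule suminf_nonneg [OF summ [OF that]]) (simp add: f01 that)
    moreover have "g p = 0"
      by (simp add: g_def f)
    ultimately obtain W where W: "openin X W" "p \<in> W" "\<And>x. x \<in> W \<Longrightarrow> g x = 0"
      using zero [OF contg _ pX] by blast
    have "x \<in> S" if "x \<in> W" for x
    proof -
      have x: "x \<in> topspace X"
        using that W(1) openin_subset by blast
      have "suminf (\<lambda>n. (1/2)^n * f n x) = 0"
        using W(3) [OF that] unfolding g_def .
      then have "f n x = 0" for n
        using suminf_eq_zero_iff [OF summ [OF x]] x by (auto simp: f01)
      then have "x \<in> C n" for n
        using f(3)[of n] x by (auto simp: image_subset_iff) (metis DiffI zero_neq_one)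
      then show ?thesis using C(2) by blast
    qed
    then show "\<exists>T. openin X T \<and> p \<in> T \<and> T \<subseteq> S"
      using W by blast
  qed
qed

section \<open>The topology generated by the G-delta sets\<close>

text \<open>The P-modification of \<open>T\<close>. G_delta sets are closed under finite
  intersection, so they form a base and openness can be tested pointwise.\<close>

definition gdelta_topology :: "'a topology \<Rightarrow> 'a topology" where
  "gdelta_topology T =
     topology (\<lambda>U. \<forall>x\<in>U. \<exists>S. gdelta_in T S \<and> x \<in> S \<and> S \<subseteq> U)"

lemma openin_gdelta_topology:
  "openin (gdelta_topology T) U \<longleftrightarrow> (\<forall>x\<in>U. \<exists>S. gdelta_in T S \<and> x \<in> S \<and> S \<subseteq> U)"
proof -
  have "istopology (\<lambda>U. \<forall>x\<in>U. \<exists>S. gdelta_in T S \<and> x \<in> S \<and> S \<subseteq> U)"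
    unfolding istopology_def
  proof (intro conjI allI impI ballI)
    fix A B x
    assume A: "\<forall>x\<in>A. \<exists>S. gdelta_in T S \<and> x \<in> S \<and> S \<subseteq> A"
      and B: "\<forall>x\<in>B. \<exists>S. gdelta_in T S \<and> x \<in> S \<and> S \<subseteq> B" and x: "x \<in> A \<inter> B"
    obtain S1 S2 where "gdelta_in T S1" "x \<in> S1" "S1 \<subseteq> A" "gdelta_in T S2" "x \<in> S2" "S2 \<subseteq> B"
      using A B x by blast
    then show "\<exists>S. gdelta_in T S \<and> x \<in> S \<and> S \<subseteq> A \<inter> B"
      by (intro exI [of _ "S1 \<inter> S2"]) (auto intro: gdelta_in_Int)
  next
    fix \<K> x
    assume "\<forall>K\<in>\<K>. \<forall>x\<in>K. \<exists>S. gdelta_in T S \<and> x \<in> S \<and> S \<subseteq> K" "x \<in> \<Union>\<K>"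
    then show "\<exists>S. gdelta_in T S \<and> x \<in> S \<and> S \<subseteq> \<Union>\<K>"
      by (meson Sup_upper2 UnionE)
  qed
  then show ?thesis
    unfolding gdelta_topology_def by (simp add: topology_inverse')
qed

lemma openin_gdelta_topology_if_gdelta_in:
  "gdelta_in T S \<Longrightarrow> openin (gdelta_topology T) S"
  unfolding openin_gdelta_topology by blast

lemma topspace_gdelta_topology [simp]: "topspace (gdelta_topology T) = topspace T"
proof
  show "topspace (gdelta_topology T) \<subseteq> topspace T"
    using openin_topspace [of "gdelta_topology T"] gdelta_in_subset
    unfolding openin_gdelta_topology by blast
  show "topspace T \<subseteq> topspace (gdelta_topology T)"
    by (intro openin_subset openin_gdelta_topology_if_gdelta_in) simp
qed

text \<open>\<open>Y\<close> and \<open>Z\<close> are kept apart to cover three uses: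
  \<open>Z\<close> the modification of \<open>Y\<close>, \<open>Z\<close> the product of the
  modifications of two factors, and \<open>Z = Y\<close> a P-space.\<close>

lemma continuous_map_into_gdelta_topology:
  assumes "continuous_map Y T f"
    and "\<And>S. gdelta_in Y S \<Longrightarrow> openin Z S" and "topspace Z = topspace Y"
  shows "continuous_map Z (gdelta_topology T) f"
  unfolding continuous_map_def
proof (intro conjI allI impI)
  show "f \<in> topspace Z \<rightarrow> topspace (gdelta_topology T)"
    using assms(1,3) by (auto simp: continuous_map_def)
  fix U assume U: "openin (gdelta_topology T) U"
  show "openin Z {x \<in> topspace Z. f x \<in> U}"
  proof (subst openin_subopen, intro ballI)
    fix x assume x: "x \<in> {x \<in> topspace Z. f x \<in> U}"
    then obtain S where S: "gdelta_in T S" "f x \<in> S" "S \<subseteq> U"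
      using U unfolding openin_gdelta_topology by blast
    have "openin Z {x \<in> topspace Y. f x \<in> S}"
      using gdelta_in_continuous_map_preimage [OF assms(1) S(1)] assms(2) by blast
    then show "\<exists>V. openin Z V \<and> x \<in> V \<and> V \<subseteq> {x \<in> topspace Z. f x \<in> U}"
      using S x assms(3) by (intro exI [of _ "{x \<in> topspace Y. f x \<in> S}"]) auto
  qed
qed

text \<open>Around a point, pick boxes \<open>A n \<times> B n\<close> inside the \<open>C n\<close>
  and intersect each factor separately. Thus the product of the modifications refines the
  modification of the product, as continuity of multiplication requires.\<close>

lemma gdelta_in_prod_topology_open:
  assumes "gdelta_in (prod_topology T T') S"
  shows "openin (prod_topology (gdelta_topology T) (gdelta_topology T')) S"
proof -
  obtain C where C: "\<And>n::nat. openin (prod_topology T T') (C n)" "\<Inter>(range C) = S"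
    using gdelta_in_sequence [OF assms] by metis
  show ?thesis
    unfolding openin_prod_topology_alt
  proof (intro allI impI)
    fix x y assume xy: "(x, y) \<in> S"
    then have "\<exists>A B. openin T A \<and> openin T' B \<and> x \<in> A \<and> y \<in> B \<and> A \<times> B \<subseteq> C n" for n
      using C unfolding openin_prod_topology_alt by blast
    then obtain A B where AB: "\<And>n. openin T (A n)" "\<And>n. openin T' (B n)" "\<And>n. x \<in> A n"
      "\<And>n. y \<in> B n" "\<And>n. A n \<times> B n \<subseteq> C n"
      by metis
    have "gdelta_in T (\<Inter>(range A))" "gdelta_in T' (\<Inter>(range B))"
      by (intro gdelta_in_Inter; auto intro: open_imp_gdelta_in AB)+
    moreover have "\<Inter>(range A) \<times> \<Inter>(range B) \<subseteq> S"
      using AB(5) C(2) by blast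
    moreover have "x \<in> \<Inter>(range A)" "y \<in> \<Inter>(range B)"
      using AB by auto
    ultimately show "\<exists>U V. openin (gdelta_topology T) U \<and> openin (gdelta_topology T') V \<and>
                       x \<in> U \<and> y \<in> V \<and> U \<times> V \<subseteq> S"
      using openin_gdelta_topology_if_gdelta_in by metis
  qed
qed

lemma topological_group_gdelta_topology:
  assumes "topological_group G T"
  shows "topological_group G (gdelta_topology T)"
  unfolding topological_group_def
proof (intro conjI)
  show "group G" "topspace (gdelta_topology T) = carrier G"
    using assms by (simp_all add: topological_group_def)
  have "continuous_map (prod_topology T T) T (\<lambda>(x, y). x \<otimes>\<^bsub>G\<^esub> y)"
    using assms by (simp add: topological_group_def)
  then show "continuous_map (prod_topology (gdelta_topology T) (gdelta_topology T))
               (gdelta_topology T) (\<lambda>(x, y). x \<otimes>\<^bsub>G\<^esub> y)"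
    by (rule continuous_map_into_gdelta_topology) (simp_all add: gdelta_in_prod_topology_open)
  have "continuous_map T T (\<lambda>x. inv\<^bsub>G\<^esub> x)"
    using assms by (simp add: topological_group_def)
  then show "continuous_map (gdelta_topology T) (gdelta_topology T) (\<lambda>x. inv\<^bsub>G\<^esub> x)"
    by (rule continuous_map_into_gdelta_topology) (simp_all add: openin_gdelta_topology_if_gdelta_in)
qed

section \<open>The finest group topology\<close>

text \<open>Pulling back along a constant map gives the indiscrete topology. It always competes in
  \<open>finest_group_topology\<close> when \<open>e\<close> maps into the carrier, and so makes the
  whole carrier a subbasic set.\<close>

lemma topological_group_indiscrete:
  assumes "group G"
  shows "topological_group G (pullback_topology (carrier G) (\<lambda>_. ()) (discrete_topology UNIV))"
proof -
  interpret group G by fact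
  show ?thesis
    unfolding topological_group_def
    by (auto simp: topspace_pullback_topology assms intro!: continuous_map_pullback')
qed

text \<open>Continuity into a pullback topology is checked after composing with \<open>h\<close>,
  where the group operations become addition and negation of reals. \<open>topological_group\<close>
  demands no separation, so \<open>h\<close> may be non-injective.\<close>

lemma topological_group_pullback:
  fixes G (structure) and h :: "'g \<Rightarrow> real"
  assumes "group G"
    and h: "\<And>x y. \<lbrakk>x \<in> carrier G; y \<in> carrier G\<rbrakk> \<Longrightarrow> h (x \<otimes> y) = h x + h y"
  shows "topological_group G (pullback_topology (carrier G) h euclideanreal)"
    (is "topological_group G ?T")
proof -
  interpret group G by fact
  have top: "topspace ?T = carrier G"
    by (simp add: topspace_pullback_topology)
  have hT: "continuous_map ?T euclideanreal h"
    using continuous_map_pullback [OF continuous_map_id [of euclideanreal]] by (simp add: o_def)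
  have "h \<one> = 0" using h [of \<one> \<one>] by simp
  then have hinv: "h (inv x) = - h x" if "x \<in> carrier G" for x
    using h [of x "inv x"] that by simp
  have "continuous_map (prod_topology ?T ?T) euclideanreal (\<lambda>z. h (fst z) + h (snd z))"
    by (intro continuous_intros continuous_map_compose [OF _ hT, unfolded o_def]
        continuous_map_fst continuous_map_snd)
  then have "continuous_map (prod_topology ?T ?T) euclideanreal (h \<circ> (\<lambda>(x, y). x \<otimes> y))"
    by (rule continuous_map_eq) (auto simp: top h)
  moreover have "continuous_map ?T euclideanreal (h \<circ> (\<lambda>x. inv x))"
    by (rule continuous_map_eq [OF continuous_map_minus [OF hT]]) (auto simp: top hinv)
  ultimately show ?thesis
    unfolding topological_group_def
    by (auto simp: top assms(1) intro!: continuous_map_pullback')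
qed

lemma openin_finest_group_topology:
  assumes "topological_group G T" "continuous_map X T e" "openin T U"
  shows "openin (finest_group_topology G X e) U"
  unfolding finest_group_topology_def
  by (rule topology_generated_by_Basis) (use assms in blast)

lemma topspace_finest_group_topology:
  assumes "group G" "e \<in> topspace X \<rightarrow> carrier G"
  shows "topspace (finest_group_topology G X e) = carrier G"
proof -
  let ?I = "pullback_topology (carrier G) (\<lambda>_. ()) (discrete_topology UNIV)"
  have I: "topological_group G ?I"
    using topological_group_indiscrete assms(1) by blast
  have "continuous_map X ?I e"
    using assms(2) by (intro continuous_map_pullback') auto
  then have "openin (finest_group_topology G X e) (carrier G)"
    using openin_finest_group_topology [OF I] I openin_topspace
    unfolding topological_group_def by metis
  moreover have "U \<subseteq> carrier G" if "openin T U" "topological_group G T" for U T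
    using that openin_subset unfolding topological_group_def by blast
  then have "topspace (finest_group_topology G X e) \<subseteq> carrier G"
    unfolding finest_group_topology_def by auto
  ultimately show ?thesis
    using openin_subset by blast
qed

lemma continuous_map_finest_group_topology_id:
  assumes "topological_group G T" "continuous_map X T e"
  shows "continuous_map (finest_group_topology G X e) T (\<lambda>x. x)"
proof -
  have "topspace (finest_group_topology G X e) = topspace T"
    using topspace_finest_group_topology [of G e X] assms
    unfolding topological_group_def continuous_map_def by auto
  moreover have "{x \<in> topspace T. x \<in> U} = U" if "openin T U" for U
    using openin_subset [OF that] by blast
  ultimately show ?thesis
    using openin_finest_group_topology [OF assms] by (auto simp: continuous_map_def)
qed

text \<open>The universal property of a supremum of topologies: only subbasic preimages need
  checking, and each subbasic set is open in one admissible \<open>T\<close>.\<close>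

lemma continuous_map_into_finest_group_topology:
  assumes "group G" "e \<in> topspace X \<rightarrow> carrier G" "f \<in> topspace Y \<rightarrow> carrier G"
    and "\<And>T. \<lbrakk>topological_group G T; continuous_map X T e\<rbrakk> \<Longrightarrow> continuous_map Y T f"
  shows "continuous_map Y (finest_group_topology G X e) f"
  unfolding finest_group_topology_def
proof (rule continuous_on_generated_topo)
  show "f ` topspace Y \<subseteq> \<Union>(\<Union>{{U. openin T U} |T. topological_group G T \<and> continuous_map X T e})"
    using topspace_finest_group_topology [OF assms(1,2)] assms(3)
    unfolding finest_group_topology_def by auto
  fix U assume "U \<in> \<Union>{{U. openin T U} |T. topological_group G T \<and> continuous_map X T e}"
  then show "openin Y (f -` U \<inter> topspace Y)"
    using assms(4) by (auto simp: continuous_map_alt)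
qed

text \<open>For each admissible \<open>T\<close> the operations, viewed as maps into
  \<open>T\<close>, factor through the continuous identity from the finest topology to
  \<open>T\<close>.\<close>

lemma topological_group_finest_group_topology:
  fixes G (structure)
  assumes "group G" "e \<in> topspace X \<rightarrow> carrier G"
  shows "topological_group G (finest_group_topology G X e)" (is "topological_group G ?F")
proof -
  interpret group G by fact
  have top: "topspace ?F = carrier G"
    by (rule topspace_finest_group_topology [OF assms])
  have "continuous_map (prod_topology ?F ?F) ?F (\<lambda>(x, y). x \<otimes> y)"
  proof (rule continuous_map_into_finest_group_topology [OF assms])
    show "(\<lambda>(x, y). x \<otimes> y) \<in> topspace (prod_topology ?F ?F) \<rightarrow> carrier G"
      by (auto simp: top)
    fix T assume T: "topological_group G T" "continuous_map X T e"
    have id: "continuous_map ?F T (\<lambda>x. x)"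
      by (rule continuous_map_finest_group_topology_id [OF T])
    have "continuous_map (prod_topology ?F ?F) (prod_topology T T) (\<lambda>z. (fst z, snd z))"
      by (intro continuous_map_pairedI continuous_map_compose [OF _ id, unfolded o_def]
          continuous_map_fst continuous_map_snd)
    moreover have "continuous_map (prod_topology T T) T (\<lambda>(x, y). x \<otimes> y)"
      using T unfolding topological_group_def by blast
    ultimately show "continuous_map (prod_topology ?F ?F) T (\<lambda>(x, y). x \<otimes> y)"
      using continuous_map_compose by (fastforce simp: o_def)
  qed
  moreover have "continuous_map ?F ?F (\<lambda>x. inv x)"
  proof (rule continuous_map_into_finest_group_topology [OF assms])
    show "(\<lambda>x. inv x) \<in> topspace ?F \<rightarrow> carrier G"
      by (auto simp: top)
    fix T assume T: "topological_group G T" "continuous_map X T e"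
    then have "continuous_map T T (\<lambda>x. inv x)"
      unfolding topological_group_def by blast
    then show "continuous_map ?F T (\<lambda>x. inv x)"
      using continuous_map_compose [OF continuous_map_finest_group_topology_id [OF T]]
      by (fastforce simp: o_def)
  qed
  ultimately show ?thesis
    unfolding topological_group_def using top assms(1) by blast
qed

lemma continuous_map_finest_group_topology_insertion:
  assumes "group G" "e \<in> topspace X \<rightarrow> carrier G"
  shows "continuous_map X (finest_group_topology G X e) e"
  using assms by (intro continuous_map_into_finest_group_topology) auto

text \<open>The topology pulled back from the reals along \<open>h\<close> is one of the
  competitors, hence coarser than the finest one.\<close>

lemma continuous_map_finest_group_topology_hom:
  fixes h :: "'g \<Rightarrow> real"
  assumes "group G" "e \<in> topspace X \<rightarrow> carrier G"
    and "\<And>x y. \<lbrakk>x \<in> carrier G; y \<in> carrier G\<rbrakk> \<Longrightarrow> h (x \<otimes>\<^bsub>G\<^esub> y) = h x + h y"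
    and "continuous_map X euclideanreal (h \<circ> e)"
  shows "continuous_map (finest_group_topology G X e) euclideanreal h"
proof -
  let ?T = "pullback_topology (carrier G) h euclideanreal"
  have "topological_group G ?T"
    using topological_group_pullback [of G h] assms(1,3) by blast
  moreover have "continuous_map X ?T e"
    using assms(2,4) by (intro continuous_map_pullback') auto
  ultimately have id: "continuous_map (finest_group_topology G X e) ?T (\<lambda>x. x)"
    by (rule continuous_map_finest_group_topology_id)
  have "continuous_map ?T euclideanreal h"
    using continuous_map_pullback [OF continuous_map_id [of euclideanreal]] by (simp add: o_def)
  with id show ?thesis
    using continuous_map_compose by (fastforce simp: o_def)
qed

lemma P_space_finest_group_topology:
  assumes "group G" "e \<in> topspace X \<rightarrow> carrier G" and X: "P_space X"
  shows "P_space (finest_group_topology G X e)"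
  unfolding P_space_def
proof (intro allI impI)
  let ?F = "finest_group_topology G X e"
  fix S assume "gdelta_in ?F S"
  then have "openin (gdelta_topology ?F) S"
    by (rule openin_gdelta_topology_if_gdelta_in)
  moreover have "topological_group G (gdelta_topology ?F)"
    by (intro topological_group_gdelta_topology topological_group_finest_group_topology assms)
  moreover have "continuous_map X (gdelta_topology ?F) e"
    using X unfolding P_space_def
    by (intro continuous_map_into_gdelta_topology [where Y = X]
        continuous_map_finest_group_topology_insertion assms) auto
  ultimately show "openin ?F S"
    using openin_finest_group_topology by blast
qed

section \<open>The F'-property forces X to be a P-space\<close>

text \<open>Freeness enters as \<open>ext\<close>, a purely algebraic extension property for
  real-valued functions; continuity of the extension comes from the finest topology. This form
  serves both free groups.\<close>

lemma F'_space_finest_group_topology_imp_P_space: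
  fixes G (structure) and X :: "'a topology"
  assumes G: "group G" and e: "e \<in> topspace X \<rightarrow> carrier G"
    and X: "completely_regular_space X" and x0: "x0 \<in> topspace X"
    and ext: "\<And>f :: 'a \<Rightarrow> real. f x0 = 0 \<Longrightarrow>
        \<exists>h. (\<forall>x\<in>carrier G. \<forall>y\<in>carrier G. h (x \<otimes>\<^bsub>G\<^esub> y) = h x + h y) \<and> (\<forall>x\<in>topspace X. h (e x) = f x)"
    and F': "F'_space (finest_group_topology G X e)"
  shows "P_space X"
proof (rule P_space_if_zero_sets_open [OF X])
  interpret group G by (rule G)
  let ?F = "finest_group_topology G X e"
  fix f :: "'a \<Rightarrow> real" and p
  assume f: "continuous_map X euclideanreal f" and nonneg: "\<And>x. x \<in> topspace X \<Longrightarrow> f x \<ge> 0"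
    and p: "p \<in> topspace X" and fp: "f p = 0"
  \<comment> \<open>Subtracting \<open>f x0\<close> meets the base point condition; the constant
    cancels in the quotients used below, where \<open>h\<close> takes the values
    \<open>f x - f p = f x\<close> and \<open>- f x\<close>.\<close>
  obtain h :: "_ \<Rightarrow> real" where
    hom: "\<And>x y. \<lbrakk>x \<in> carrier G; y \<in> carrier G\<rbrakk> \<Longrightarrow> h (x \<otimes> y) = h x + h y"
    and he: "\<And>x. x \<in> topspace X \<Longrightarrow> h (e x) = f x - f x0"
    using ext [of "\<lambda>x. f x - f x0"] by auto
  have "h \<one> = 0" using hom [of \<one> \<one>] by simp
  then have hinv: "h (inv x) = - h x" if "x \<in> carrier G" for x
    using hom [of x "inv x"] that by simp
  have ec: "e x \<in> carrier G" if "x \<in> topspace X" for x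
    using e that by blast
  have top: "topspace ?F = carrier G"
    by (rule topspace_finest_group_topology [OF G e])
  have TG: "topological_group G ?F"
    by (rule topological_group_finest_group_topology [OF G e])
  have "continuous_map X euclideanreal (\<lambda>x. f x - f x0)"
    by (intro continuous_intros f)
  then have "continuous_map X euclideanreal (h \<circ> e)"
    by (rule continuous_map_eq) (simp add: he)
  then have hcont: "continuous_map ?F euclideanreal h"
    by (intro continuous_map_finest_group_topology_hom G e hom)
  have econt: "continuous_map X ?F e"
    by (rule continuous_map_finest_group_topology_insertion [OF G e])
  have mult: "continuous_map X ?F (\<lambda>x. u x \<otimes> v x)"
    if "continuous_map X ?F u" "continuous_map X ?F v" for u v
  proof -
    have "continuous_map X (prod_topology ?F ?F) (\<lambda>x. (u x, v x))"
      by (intro continuous_map_pairedI that)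
    then show ?thesis
      using TG continuous_map_compose unfolding topological_group_def
      by (fastforce simp: o_def)
  qed
  have inv: "continuous_map X ?F (\<lambda>x. inv (e x))"
    using TG continuous_map_compose [OF econt] unfolding topological_group_def
    by (fastforce simp: o_def)
  have const: "continuous_map X ?F (\<lambda>_. c)" if "c \<in> carrier G" for c
    using that top by simp
  show "\<exists>W. openin X W \<and> p \<in> W \<and> (\<forall>x\<in>W. f x = 0)"
  proof (rule ccontr)
    assume contra: "\<not> ?thesis"
    \<comment> \<open>By \<open>contra\<close>, every neighbourhood of \<open>p\<close> contains a
      point where \<open>f\<close> is nonzero, hence positive, and \<open>u\<close> carries points
      close to \<open>p\<close> into any given neighbourhood of the identity. The predicate
      \<open>P\<close> lets both signs share the argument.\<close>
    have limit: "\<one> \<in> ?F closure_of {y \<in> topspace ?F. P (h y)}"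
      if u: "continuous_map X ?F u" "u p = \<one>" and P: "\<And>x. \<lbrakk>x \<in> topspace X; f x > 0\<rbrakk> \<Longrightarrow> P (h (u x))"
      for u and P
      unfolding in_closure_of
    proof (intro conjI allI impI)
      show "\<one> \<in> topspace ?F" by (simp add: top)
      fix T assume T: "\<one> \<in> T \<and> openin ?F T"
      let ?W = "{x \<in> topspace X. u x \<in> T}"
      have "openin X ?W"
        using T by (intro openin_continuous_map_preimage [OF u(1)]) auto
      moreover have "p \<in> ?W" using p u T by simp
      ultimately obtain x where x: "x \<in> ?W" "f x \<noteq> 0" using contra by blast
      then have "P (h (u x))" using P nonneg [of x] by auto
      moreover have "u x \<in> topspace ?F"
        using x T openin_subset by blast
      ultimately show "\<exists>y. y \<in> {y \<in> topspace ?F. P (h y)} \<and> y \<in> T"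
        using x by blast
    qed
    \<comment> \<open>These are the cozero sets of \<open>max (h y) 0\<close> and
      \<open>min (h y) 0\<close>: disjoint, yet both accumulate at the identity.\<close>
    let ?U = "{y \<in> topspace ?F. h y > 0}" and ?V = "{y \<in> topspace ?F. h y < 0}"
    have "\<one> \<in> ?F closure_of ?U"
    proof (rule limit [where u = "\<lambda>x. e x \<otimes> inv (e p)"])
      show "continuous_map X ?F (\<lambda>x. e x \<otimes> inv (e p))"
        by (intro mult econt const) (simp add: ec p)
    qed (auto simp: ec p hom hinv he fp)
    moreover have "\<one> \<in> ?F closure_of ?V"
    proof (rule limit [where u = "\<lambda>x. e p \<otimes> inv (e x)"])
      show "continuous_map X ?F (\<lambda>x. e p \<otimes> inv (e x))"
        by (intro mult inv const) (simp add: ec p)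
    qed (auto simp: ec p hom hinv he fp)
    moreover have "cozero_set ?F ?U"
      unfolding cozero_set_def
      by (rule exI [of _ "\<lambda>y. max (h y) 0"]) (auto intro!: continuous_intros hcont)
    moreover have "cozero_set ?F ?V"
      unfolding cozero_set_def
      by (rule exI [of _ "\<lambda>y. min (h y) 0"]) (auto intro!: continuous_intros hcont)
    moreover have "?U \<inter> ?V = {}" by auto
    ultimately show False
      using F' unfolding F'_space_def by blast
  qed
qed

lemma F'_space_finest_group_topology_iff_P_space:
  fixes X :: "'a topology"
  assumes "group G" "e \<in> topspace X \<rightarrow> carrier G"
    and "completely_regular_space X" "x0 \<in> topspace X"
    and "\<And>f :: 'a \<Rightarrow> real. f x0 = 0 \<Longrightarrow>
        \<exists>h. (\<forall>x\<in>carrier G. \<forall>y\<in>carrier G. h (x \<otimes>\<^bsub>G\<^esub> y) = h x + h y) \<and> (\<forall>x\<in>topspace X. h (e x) = f x)"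
  shows "F'_space (finest_group_topology G X e) \<longleftrightarrow> P_space X"
  using F'_space_finest_group_topology_imp_P_space [OF assms]
    P_space_imp_F'_space P_space_finest_group_topology [OF assms(1,2)] by blast

section \<open>The free group of reduced words\<close>

text \<open>The recursion step of \<open>reduce_word\<close>, isolated so that each letter acts on
  reduced words and reduction is a right fold of these actions, as in van der Waerden's construction
  of free groups.\<close>

definition cons_reduce :: "'a \<times> bool \<Rightarrow> ('a \<times> bool) list \<Rightarrow> ('a \<times> bool) list" where
  "cons_reduce a w = (case w of [] \<Rightarrow> [a]
     | b # v \<Rightarrow> (if fst a = fst b \<and> snd a \<noteq> snd b then v else a # b # v))"

lemma reduce_word_Cons: "reduce_word (a # w) = cons_reduce a (reduce_word w)"
  by (simp add: cons_reduce_def)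

lemma reduce_word_append: "reduce_word (u @ v) = foldr cons_reduce u (reduce_word v)"
  by (induction u) (simp_all add: reduce_word_Cons del: reduce_word.simps(2))

lemma reduced_word_ConsD: "reduced_word (a # w) \<Longrightarrow> reduced_word w"
  by (cases w) auto

lemma reduced_word_cons_reduce: "reduced_word w \<Longrightarrow> reduced_word (cons_reduce a w)"
  by (cases w) (auto simp: cons_reduce_def dest: reduced_word_ConsD)

lemma reduced_word_reduce_word: "reduced_word (reduce_word w)"
  by (induction w)
     (simp_all add: reduce_word_Cons reduced_word_cons_reduce del: reduce_word.simps(2))

lemma reduce_word_reduced: "reduced_word w \<Longrightarrow> reduce_word w = w"
  by (induction w rule: reduced_word.induct) auto

text \<open>Opposite letters undo each other: if \<open>b\<close> cancels the head of
  \<open>w\<close>, that head is \<open>a\<close>, and since \<open>w\<close> is reduced,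
  \<open>a\<close> can be put back without a further cancellation.\<close>

lemma cons_reduce_cancel:
  assumes "reduced_word w" "fst a = fst b" "snd a \<noteq> snd b"
  shows "cons_reduce a (cons_reduce b w) = w"
proof (cases w)
  case Nil
  then show ?thesis using assms by (simp add: cons_reduce_def)
next
  case (Cons c v)
  show ?thesis
  proof (cases "fst b = fst c \<and> snd b \<noteq> snd c")
    case True
    then have "a = c" using assms by (auto simp: prod_eq_iff)
    then show ?thesis
      using True Cons assms(1) by (cases v) (auto simp: cons_reduce_def)
  next
    case False
    then show ?thesis using Cons assms by (auto simp: cons_reduce_def)
  qed
qed

lemma reduce_word_append_reduce_left: "reduce_word (reduce_word u @ v) = reduce_word (u @ v)"
proof (induction u)
  case Nil
  show ?case by simp
next
  case (Cons a u)
  show ?case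
  proof (cases "reduce_word u")
    case Nil
    then show ?thesis using Cons by simp
  next
    case (Cons b r)
    have "cons_reduce b (reduce_word (r @ v)) = reduce_word (u @ v)"
      using Cons.IH Cons by (metis append_Cons reduce_word_Cons)
    \<comment> \<open>If \<open>a\<close> cancels the head \<open>b\<close> of the reduced prefix,
      \<open>r\<close> is what remains of it; acting with \<open>a\<close> undoes the action of
      \<open>b\<close> in the preceding equation.\<close>
    then have "cons_reduce a (reduce_word (u @ v)) = reduce_word (r @ v)"
      if "fst a = fst b" "snd a \<noteq> snd b"
      using cons_reduce_cancel [OF reduced_word_reduce_word that] by metis
    then show ?thesis
      using Cons Cons.IH by (auto simp: reduce_word_Cons simp del: reduce_word.simps(2))
        (auto simp: cons_reduce_def reduce_word_Cons simp del: reduce_word.simps(2))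
  qed
qed

lemma reduce_word_append_reduce_right: "reduce_word (u @ reduce_word v) = reduce_word (u @ v)"
  by (simp add: reduce_word_append reduce_word_reduced reduced_word_reduce_word)

lemma set_reduce_word: "set (reduce_word w) \<subseteq> set w"
  by (induction w) (auto split: list.splits if_splits)

lemma reduce_word_inverse_left:
  "reduce_word (rev (map (\<lambda>(x, b). (x, \<not> b)) w) @ w) = []"
proof (induction w)
  case Nil
  show ?case by simp
next
  case (Cons a w)
  \<comment> \<open>The last letter of the formal inverse of \<open>a # w\<close> meets
    \<open>a\<close>; removing this innermost pair leaves the claim for \<open>w\<close>.\<close>
  have "cons_reduce (fst a, \<not> snd a) (cons_reduce a (reduce_word w)) = reduce_word w"
    by (rule cons_reduce_cancel) (simp_all add: reduced_word_reduce_word)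
  then show ?case
    using Cons
    by (simp add: reduce_word_append reduce_word_Cons case_prod_beta del: reduce_word.simps(2))
qed

lemma reduce_word_in_free_group:
  assumes "fst ` set w \<subseteq> S"
  shows "reduce_word w \<in> carrier (free_group S)"
  using order_trans [OF image_mono [OF set_reduce_word] assms]
  by (simp add: free_group_def reduced_word_reduce_word)

lemma group_free_group: "group (free_group S)"
proof (rule groupI)
  fix u v assume "u \<in> carrier (free_group S)" "v \<in> carrier (free_group S)"
  then show "u \<otimes>\<^bsub>free_group S\<^esub> v \<in> carrier (free_group S)"
    using reduce_word_in_free_group [of "u @ v" S] by (simp add: free_group_def image_Un)
next
  fix w assume w: "w \<in> carrier (free_group S)"
  \<comment> \<open>\<open>groupI\<close> asks for a left inverse only. Reducing the formal inverse
    puts it in the carrier at once.\<close>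
  let ?v = "rev (map (\<lambda>(x, b). (x, \<not> b)) w)"
  have "fst ` set ?v \<subseteq> S"
    using w by (auto simp: free_group_def)
  then have "reduce_word ?v \<in> carrier (free_group S)"
    by (rule reduce_word_in_free_group)
  moreover have "reduce_word ?v \<otimes>\<^bsub>free_group S\<^esub> w = \<one>\<^bsub>free_group S\<^esub>"
    by (simp add: free_group_def reduce_word_append_reduce_left reduce_word_inverse_left)
  ultimately show "\<exists>v\<in>carrier (free_group S). v \<otimes>\<^bsub>free_group S\<^esub> w = \<one>\<^bsub>free_group S\<^esub>"
    by blast
qed (auto simp: free_group_def reduce_word_append_reduce_left reduce_word_append_reduce_right
      reduce_word_reduced)

text \<open>The exponent sum weighted by \<open>f\<close>, defined on all words: it is additive
  under concatenation and survives reduction, since a cancelled pair contributes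
  \<open>f x - f x\<close>.\<close>

definition word_sum :: "('a \<Rightarrow> real) \<Rightarrow> ('a \<times> bool) list \<Rightarrow> real" where
  "word_sum f w = (\<Sum>(x, b)\<leftarrow>w. if b then f x else - f x)"

lemma word_sum_reduce_word: "word_sum f (reduce_word w) = word_sum f w"
  by (induction w) (auto simp: word_sum_def split: list.splits if_splits)

section \<open>Graev free groups\<close>

lemma F'_space_graev_free_topology_iff:
  assumes "completely_regular_space X" "x0 \<in> topspace X"
  shows "F'_space (graev_free_topology X x0) \<longleftrightarrow> P_space X"
  unfolding graev_free_topology_def
proof (rule F'_space_finest_group_topology_iff_P_space [OF _ _ assms])
  show "group (graev_free_group X x0)"
    by (simp add: graev_free_group_def group_free_group)
  show "graev_ins x0 \<in> topspace X \<rightarrow> carrier (graev_free_group X x0)"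
    by (auto simp: graev_ins_def graev_free_group_def free_group_def)
  fix f :: "'a \<Rightarrow> real" assume "f x0 = 0"
  moreover have "word_sum f (u \<otimes>\<^bsub>graev_free_group X x0\<^esub> v) = word_sum f u + word_sum f v" for u v
    by (simp add: graev_free_group_def free_group_def word_sum_reduce_word) (simp add: word_sum_def)
  \<comment> \<open>At \<open>x0\<close> the insertion is the empty word, whose sum 0 agrees with
    \<open>f x0\<close>.\<close>
  ultimately show "\<exists>h. (\<forall>x\<in>carrier (graev_free_group X x0). \<forall>y\<in>carrier (graev_free_group X x0).
        h (x \<otimes>\<^bsub>graev_free_group X x0\<^esub> y) = h x + h y) \<and> (\<forall>x\<in>topspace X. h (graev_ins x0 x) = f x)"
    by (intro exI [of _ "word_sum f"]) (auto simp: word_sum_def graev_ins_def)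
qed

lemma F'_space_graev_free_ab_topology_iff:
  assumes "completely_regular_space X" "x0 \<in> topspace X"
  shows "F'_space (graev_free_ab_topology X x0) \<longleftrightarrow> P_space X"
  unfolding graev_free_ab_topology_def
proof (rule F'_space_finest_group_topology_iff_P_space [OF _ _ assms])
  show "group (graev_free_ab_group X x0)"
    by (simp add: graev_free_ab_group_def)
  show "graev_ab_ins x0 \<in> topspace X \<rightarrow> carrier (graev_free_ab_group X x0)"
    by (auto simp: graev_ab_ins_def graev_free_ab_group_def keys_frag_of)
  fix f :: "'a \<Rightarrow> real" assume f: "f x0 = 0"
  define h where "h c = (\<Sum>x\<in>Poly_Mapping.keys c. of_int (Poly_Mapping.lookup c x) * f x)"
    for c :: "'a \<Rightarrow>\<^sub>0 int"
  \<comment> \<open>The supports of \<open>c\<close>, \<open>d\<close> and \<open>c + d\<close> may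
    differ; the sums still add up because a term with coefficient 0 vanishes and terms are additive
    in the coefficient.\<close>
  have "h (c + d) = h c + h d" for c d
    unfolding h_def
    by (rule setsum_keys_plus_distrib [where f = "\<lambda>x n. of_int n * f x"]) (auto simp: algebra_simps)
  moreover have "h (graev_ab_ins x0 x) = f x" for x
    using f by (auto simp: h_def graev_ab_ins_def keys_frag_of lookup_frag_of)
  ultimately show "\<exists>h. (\<forall>x\<in>carrier (graev_free_ab_group X x0). \<forall>y\<in>carrier (graev_free_ab_group X x0).
        h (x \<otimes>\<^bsub>graev_free_ab_group X x0\<^esub> y) = h x + h y) \<and> (\<forall>x\<in>topspace X. h (graev_ab_ins x0 x) = f x)"
    by (intro exI [of _ h]) (auto simp: graev_free_ab_group_def)
qed

theorem theorem4:
  fixes X :: "'a topology" and x0 :: 'a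
  assumes "tychonoff_space X" and "x0 \<in> topspace X"
  shows "(F'_space (graev_free_topology X x0) \<longleftrightarrow> F'_space (graev_free_ab_topology X x0))
       \<and> (F'_space (graev_free_ab_topology X x0) \<longleftrightarrow> P_space X)"
proof -
  have "completely_regular_space X"
    using assms(1) by (simp add: tychonoff_space_def)
  then show ?thesis
    using assms(2) by (simp add: F'_space_graev_free_topology_iff F'_space_graev_free_ab_topology_iff)
qed

end
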